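(* Let $k\ge 0$ be an integer. As formal power series, $$\sum_{n\geq 0} F_{n-k}^n x^n = \frac{k!\cdot x^{2k}}{\left(\prod_{i=1}^k (1-ix)\right)^2\cdot(1-(k+1)x)},$$ where $F_{n-k}^n$ is the number of maximal rook placements with exactly $n-k$ rooks on the triangular board $\Psi_{1,\ldots,1}$ of size $n$.
   Context: The triangular board $\Psi_{1,\ldots,1}$ of size $n$ is the set of squares $\{(i,j): 1\le i\le j\le n\}$, where $i$ is the column and $j$ is the row. A rook placement is a set of squares, no two in the same row and no two in the same column; it is maximal if no further square of the board can be added to it so that it remains a rook placement. Conventions: the board of size $0$ is empty (its only rook placement, the empty one, is maximal, so $F_0^0=1$), and $F^n_{n-k}=0$ if $n<k$. *)

theory Defs
  imports "HOL-Computational_Algebra.Formal_Power_Series"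
begin

text \<open>
  A square is a pair \<open>(i, j)\<close> with \<open>i\<close> the column and \<open>j\<close> the row.
\<close>

definition triangular_board :: "nat \<Rightarrow> (nat \<times> nat) set" where
  "triangular_board n = {(i, j). 1 \<le> i \<and> i \<le> j \<and> j \<le> n}"

definition rook_placement :: "(nat \<times> nat) set \<Rightarrow> (nat \<times> nat) set \<Rightarrow> bool" where
  "rook_placement B R \<longleftrightarrow>
     R \<subseteq> B \<and> (\<forall>s\<in>R. \<forall>t\<in>R. s \<noteq> t \<longrightarrow> fst s \<noteq> fst t \<and> snd s \<noteq> snd t)"

definition maximal_rook_placement :: "(nat \<times> nat) set \<Rightarrow> (nat \<times> nat) set \<Rightarrow> bool" where
  "maximal_rook_placement B R \<longleftrightarrow>
     rook_placement B R \<and> (\<forall>s\<in>B - R. \<not> rook_placement B (insert s R))"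

definition num_maximal :: "nat \<Rightarrow> nat \<Rightarrow> nat" where
  "num_maximal n m = card {R. maximal_rook_placement (triangular_board n) R \<and> card R = m}"

text \<open>
  The number \<open>F\<^sup>n\<^sub>n\<^sub>-\<^sub>k\<close>. The case distinction is needed because subtraction on \<open>nat\<close> truncates:
  for \<open>n = 0 < k\<close> the expression \<open>num_maximal n (n - k)\<close> would be \<open>1\<close> instead of \<open>0\<close>.
\<close>

definition maximal_count :: "nat \<Rightarrow> nat \<Rightarrow> nat" where
  "maximal_count n k = (if n < k then 0 else num_maximal n (n - k))"

end

theory Submission
  imports Defs
begin

text \<open>
  Build a placement on the board of size \<open>n + 1\<close> from one on the board of size \<open>n\<close> by filling the
  last row, and keep track of the number \<open>s\<close> of empty columns and the number \<open>g\<close> of those empty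
  columns that lie to the right of every empty row. Leaving the new row empty leads
  from \<open>(s, g)\<close> to \<open>(s + 1, 0)\<close>; a rook in the new column or in one of the \<open>g\<close> columns
  keeps the state; a rook in one of the \<open>s - g\<close> other empty columns leads to \<open>(s, g + 1)\<close>, because
  the new column takes the place of the column filled. Maximality means \<open>g = s\<close>. Forgetting \<open>g\<close>
  gives the Stirling recurrence for all placements, which feeds the states \<open>(s, 0)\<close>; from there
  the states \<open>(s, g)\<close> are reached one after the other up to \<open>(s, s)\<close>.
\<close>

section \<open>Placements, their empty columns and rows, and maximality\<close>

definition placements :: "nat \<Rightarrow> (nat \<times> nat) set set" where
  "placements n = {R. rook_placement (triangular_board n) R}"

definition empty_columns :: "nat \<Rightarrow> (nat \<times> nat) set \<Rightarrow> nat set" where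
  "empty_columns n R = {1..n} - fst ` R"

definition empty_rows :: "nat \<Rightarrow> (nat \<times> nat) set \<Rightarrow> nat set" where
  "empty_rows n R = {1..n} - snd ` R"

definition late_columns :: "nat \<Rightarrow> (nat \<times> nat) set \<Rightarrow> nat set" where
  "late_columns n R = {i \<in> empty_columns n R. \<forall>j\<in>empty_rows n R. j < i}"

lemma rook_placement_iff_inj_on:
  "rook_placement B R \<longleftrightarrow> R \<subseteq> B \<and> inj_on fst R \<and> inj_on snd R"
  unfolding rook_placement_def inj_on_def by blast

lemma finite_triangular_board: "finite (triangular_board n)"
  by (rule finite_subset[of _ "{1..n} \<times> {1..n}"]) (auto simp: triangular_board_def)

lemma finite_placements: "finite (placements n)"
  by (rule finite_subset[of _ "Pow (triangular_board n)"])
    (auto simp: placements_def rook_placement_def finite_triangular_board)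

lemma placements_0: "placements 0 = {{}}"
  by (auto simp: placements_def rook_placement_def triangular_board_def)

lemma placementsD:
  assumes "R \<in> placements n"
  shows "R \<subseteq> triangular_board n" "inj_on fst R" "inj_on snd R" "finite R"
    "fst ` R \<subseteq> {1..n}" "snd ` R \<subseteq> {1..n}"
proof -
  show "R \<subseteq> triangular_board n" "inj_on fst R" "inj_on snd R"
    using assms by (auto simp: placements_def rook_placement_iff_inj_on)
  then show "finite R" "fst ` R \<subseteq> {1..n}" "snd ` R \<subseteq> {1..n}"
    using finite_subset[OF _ finite_triangular_board[of n]]
    by (auto simp: triangular_board_def)
qed

lemma finite_empty_columns: "finite (empty_columns n R)"
  by (simp add: empty_columns_def)

lemma finite_late_columns: "finite (late_columns n R)"
  by (simp add: late_columns_def finite_empty_columns)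

lemma late_columns_subset: "late_columns n R \<subseteq> empty_columns n R"
  by (auto simp: late_columns_def)

lemma card_empty_columns:
  assumes "R \<in> placements n"
  shows "card (empty_columns n R) + card R = n"
proof -
  have "card (empty_columns n R) + card (fst ` R) = n"
    unfolding empty_columns_def using placementsD[OF assms]
    by (metis card_Diff_subset card_atLeastAtMost card_mono diff_Suc_1 finite_atLeastAtMost
        finite_imageI le_add_diff_inverse2)
  then show ?thesis
    using placementsD(2)[OF assms] by (simp add: card_image)
qed

lemma insert_rook_placement_iff:
  assumes R: "R \<in> placements n" and s: "s \<in> triangular_board n - R"
  shows "rook_placement (triangular_board n) (insert s R) \<longleftrightarrow>
    fst s \<in> empty_columns n R \<and> snd s \<in> empty_rows n R"
proof -
  have "rook_placement (triangular_board n) (insert s R) \<longleftrightarrow> fst s \<notin> fst ` R \<and> snd s \<notin> snd ` R"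
    using s placementsD(1-3)[OF R] by (auto simp: rook_placement_iff_inj_on)
  moreover have "fst s \<in> {1..n}" "snd s \<in> {1..n}"
    using s by (auto simp: triangular_board_def)
  ultimately show ?thesis
    by (simp add: empty_columns_def empty_rows_def)
qed

text \<open>A square can be added exactly when its column and its row are both empty, and an empty
  column \<open>i\<close> and an empty row \<open>j\<close> meet on the board exactly when
  \<open>i \<le> j\<close>. So nothing can be added iff no empty column has an empty row at or
  beyond its index.\<close>

lemma maximal_iff_late_columns:
  assumes R: "R \<in> placements n"
  shows "maximal_rook_placement (triangular_board n) R \<longleftrightarrow> late_columns n R = empty_columns n R"
proof -
  have "maximal_rook_placement (triangular_board n) R \<longleftrightarrow>
    (\<forall>s\<in>triangular_board n - R. \<not> (fst s \<in> empty_columns n R \<and> snd s \<in> empty_rows n R))"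
    using R insert_rook_placement_iff[OF R]
    by (auto simp: maximal_rook_placement_def placements_def)
  also have "\<dots> \<longleftrightarrow> (\<forall>i\<in>empty_columns n R. \<forall>j\<in>empty_rows n R. \<not> i \<le> j)"
  proof
    assume *: "\<forall>s\<in>triangular_board n - R.
      \<not> (fst s \<in> empty_columns n R \<and> snd s \<in> empty_rows n R)"
    show "\<forall>i\<in>empty_columns n R. \<forall>j\<in>empty_rows n R. \<not> i \<le> j"
    proof (intro ballI notI)
      fix i j assume ij: "i \<in> empty_columns n R" "j \<in> empty_rows n R" "i \<le> j"
      then have "(i, j) \<in> triangular_board n - R"
        by (force simp: empty_columns_def empty_rows_def triangular_board_def)
      with *[rule_format, of "(i, j)"] ij show False by simp
    qed
  qed (force simp: triangular_board_def)
  also have "\<dots> \<longleftrightarrow> late_columns n R = empty_columns n R"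
    by (auto simp: late_columns_def not_le)
  finally show ?thesis .
qed

lemma maximal_iff_card_late_columns:
  assumes "R \<in> placements n"
  shows "maximal_rook_placement (triangular_board n) R \<longleftrightarrow>
    card (late_columns n R) = card (empty_columns n R)"
  using maximal_iff_late_columns[OF assms] card_subset_eq[OF finite_empty_columns late_columns_subset]
  by metis

section \<open>Adding the last row\<close>

text \<open>The squares in rows up to \<open>n\<close> form the smaller board, so erasing the last
  row leaves a placement there. Conversely, the last row meets every column, so its rook may go into
  any empty column, including the new one.\<close>

lemma placements_Suc:
  "placements (Suc n) = placements n \<union>
    (\<lambda>(R, i). insert (i, Suc n) R) ` (SIGMA R:placements n. empty_columns (Suc n) R)"
  (is "_ = _ \<union> ?f ` ?S")
proof (intro equalityI subsetI)
  fix R assume R: "R \<in> placements (Suc n)"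
  define R' where "R' = {s \<in> R. snd s \<noteq> Suc n}"
  have R': "R' \<in> placements n"
    using placementsD(1-3)[OF R] unfolding placements_def rook_placement_iff_inj_on
    by (auto simp: R'_def triangular_board_def le_Suc_eq inj_on_def)
  show "R \<in> placements n \<union> ?f ` ?S"
  proof (cases "\<exists>i. (i, Suc n) \<in> R")
    case True
    then obtain i where i: "(i, Suc n) \<in> R" by blast
    have "R = insert (i, Suc n) R'"
      using i placementsD(3)[OF R] by (fastforce simp: R'_def inj_on_def)
    moreover have "i \<in> empty_columns (Suc n) R'"
      using i placementsD(1,2)[OF R]
      by (fastforce simp: R'_def empty_columns_def inj_on_def triangular_board_def)
    ultimately show ?thesis using R' by (auto simp: image_iff)
  next
    case False
    then have "R' = R" by (auto simp: R'_def)
    then show ?thesis using R' by simp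
  qed
next
  fix R assume "R \<in> placements n \<union> ?f ` ?S"
  then consider "R \<in> placements n"
    | R' i where "R' \<in> placements n" "i \<in> empty_columns (Suc n) R'" "R = insert (i, Suc n) R'"
    by auto
  then show "R \<in> placements (Suc n)"
  proof cases
    case 1
    then show ?thesis
      by (auto simp: placements_def rook_placement_def triangular_board_def)
  next
    case 2
    then show ?thesis
      using placementsD(1-3,6)[OF 2(1)] unfolding placements_def rook_placement_iff_inj_on
      by (force simp: triangular_board_def empty_columns_def)
  qed
qed

text \<open>A placement on the smaller board has no square in row \<open>Suc n\<close>. Hence the
  two cases of \<open>placements_Suc\<close> are disjoint, and both the added rook and the rest can
  be recovered from the result.\<close>

lemma sum_placements_Suc:
  fixes f :: "(nat \<times> nat) set \<Rightarrow> nat"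
  shows "(\<Sum>R\<in>placements (Suc n). f R) =
    (\<Sum>R\<in>placements n. f R + (\<Sum>i\<in>empty_columns (Suc n) R. f (insert (i, Suc n) R)))"
proof -
  let ?S = "SIGMA R:placements n. empty_columns (Suc n) R"
  let ?F = "\<lambda>(R, i). insert (i, Suc n) R"
  have notin: "(i, Suc n) \<notin> R" if "R \<in> placements n" for R i
    using placementsD(1)[OF that] by (auto simp: triangular_board_def)
  have "inj_on ?F ?S"
  proof (rule inj_onI, clarify)
    fix R i R' i' assume *: "R \<in> placements n" "R' \<in> placements n"
      "insert (i, Suc n) R = insert (i', Suc n) R'"
    then have "i = i'" using notin by blast
    then show "R = R' \<and> i = i'" using * notin by (metis insert_ident)
  qed
  then have "sum f (?F ` ?S) = (\<Sum>(R, i)\<in>?S. f (insert (i, Suc n) R))"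
    by (simp only: sum.reindex) (simp add: case_prod_beta)
  also have "\<dots> = (\<Sum>R\<in>placements n. \<Sum>i\<in>empty_columns (Suc n) R. f (insert (i, Suc n) R))"
    by (simp add: sum.Sigma finite_placements finite_empty_columns)
  finally have "sum f (?F ` ?S) = \<dots>" .
  moreover have "placements n \<inter> ?F ` ?S = {}"
    using notin by blast
  ultimately show ?thesis
    unfolding placements_Suc
    by (subst sum.union_disjoint)
      (auto simp: finite_placements finite_empty_columns sum.distrib intro!: finite_imageI)
qed

section \<open>Effect of the last row on the empty and late columns\<close>

context
  fixes n R
  assumes R: "R \<in> placements n"
begin

lemma empty_columns_Suc: "empty_columns (Suc n) R = insert (Suc n) (empty_columns n R)"
  using placementsD(5)[OF R] by (auto simp: empty_columns_def le_Suc_eq)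

lemma Suc_notin_empty_columns: "Suc n \<notin> empty_columns n R"
  by (simp add: empty_columns_def)

text \<open>Once row \<open>Suc n\<close> stays empty, no column lies to the right of it.\<close>

lemma late_columns_Suc: "late_columns (Suc n) R = {}"
proof -
  have "Suc n \<in> empty_rows (Suc n) R"
    using placementsD(6)[OF R] by (auto simp: empty_rows_def)
  then show ?thesis by (force simp: late_columns_def empty_columns_def)
qed

lemma empty_columns_insert:
  "empty_columns (Suc n) (insert (i, Suc n) R) = insert (Suc n) (empty_columns n R) - {i}"
  using empty_columns_Suc by (auto simp: empty_columns_def)

text \<open>A rook in the last row leaves the set of empty rows as it was. All of these are at most
  \<open>n\<close>, so the new column counts as late, unless it is the one filled.\<close>

lemma late_columns_insert:
  "late_columns (Suc n) (insert (i, Suc n) R) = insert (Suc n) (late_columns n R) - {i}"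
proof -
  have "empty_rows (Suc n) (insert (i, Suc n) R) = empty_rows n R"
    by (auto simp: empty_rows_def le_Suc_eq)
  moreover have "\<forall>j\<in>empty_rows n R. j < Suc n"
    by (auto simp: empty_rows_def)
  ultimately show ?thesis
    unfolding late_columns_def empty_columns_insert by auto
qed

lemma sum_insert_rook:
  fixes h :: "nat \<Rightarrow> nat \<Rightarrow> nat"
  defines "s \<equiv> card (empty_columns n R)" and "g \<equiv> card (late_columns n R)"
  shows "(\<Sum>i\<in>empty_columns (Suc n) R.
      h (card (empty_columns (Suc n) (insert (i, Suc n) R)))
        (card (late_columns (Suc n) (insert (i, Suc n) R)))) =
    (g + 1) * h s g + (s - g) * h s (g + 1)"
proof -
  let ?E = "empty_columns n R" and ?L = "late_columns n R"
  let ?h = "\<lambda>i. h (card (empty_columns (Suc n) (insert (i, Suc n) R)))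
        (card (late_columns (Suc n) (insert (i, Suc n) R)))"
  have notin: "Suc n \<notin> ?E" "Suc n \<notin> ?L"
    using Suc_notin_empty_columns late_columns_subset by blast+
  \<comment> \<open>The new column raises the number of empty columns by one and the rook lowers it
    by one.\<close>
  have E: "card (empty_columns (Suc n) (insert (i, Suc n) R)) = s" if "i \<in> insert (Suc n) ?E" for i
    using that notin unfolding empty_columns_insert s_def
    by (simp add: card_Diff_singleton_if finite_empty_columns)
  have L1: "?h i = h s g" if "i \<in> insert (Suc n) ?L" for i
  proof -
    have "card (late_columns (Suc n) (insert (i, Suc n) R)) = g"
      using that notin unfolding late_columns_insert g_def
      by (simp add: card_Diff_singleton_if finite_late_columns)
    moreover have "i \<in> insert (Suc n) ?E" using that late_columns_subset by blast
    ultimately show ?thesis using E by simp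
  qed
  have L2: "?h i = h s (g + 1)" if "i \<in> ?E - ?L" for i
  proof -
    have "i \<noteq> Suc n" using that notin by blast
    then have "card (late_columns (Suc n) (insert (i, Suc n) R)) = g + 1"
      using that notin unfolding late_columns_insert g_def
      by (simp add: card_Diff_singleton_if finite_late_columns)
    then show ?thesis using E that by simp
  qed
  \<comment> \<open>The \<open>g + 1\<close> columns of the first part are late after the new column
    is added, so filling one brings the late count back to \<open>g\<close>; filling one of the
    second part leaves all \<open>g + 1\<close> of them empty.\<close>
  have "empty_columns (Suc n) R = insert (Suc n) ?L \<union> (?E - ?L)"
    using empty_columns_Suc late_columns_subset by blast
  then have "sum ?h (empty_columns (Suc n) R) = sum ?h (insert (Suc n) ?L) + sum ?h (?E - ?L)"
    using notin
    by (simp only:) (rule sum.union_disjoint, auto simp: finite_empty_columns finite_late_columns)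
  also have "\<dots> = (\<Sum>i\<in>insert (Suc n) ?L. h s g) + (\<Sum>i\<in>?E - ?L. h s (g + 1))"
    using L1 L2 by (intro arg_cong2[where f = "(+)"] sum.cong) auto
  also have "\<dots> = (g + 1) * h s g + (s - g) * h s (g + 1)"
    using notin late_columns_subset
    by (simp add: s_def g_def card_Diff_subset finite_late_columns)
  finally show ?thesis .
qed

end

section \<open>Recurrences for the numbers of states\<close>

text \<open>Summing an arbitrary weight \<open>h\<close> over the states turns the transition rule
  into one identity, \<open>state_sum_Suc\<close>; each recurrence below is its instance for an
  indicator weight.\<close>

definition state_sum :: "nat \<Rightarrow> (nat \<Rightarrow> nat \<Rightarrow> nat) \<Rightarrow> nat" where
  "state_sum n h =
    (\<Sum>R\<in>placements n. h (card (empty_columns n R)) (card (late_columns n R)))"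

lemma state_sum_0: "state_sum 0 h = h 0 0"
  by (simp add: state_sum_def placements_0 late_columns_def empty_columns_def)

lemma state_sum_Suc:
  "state_sum (Suc n) h =
    state_sum n (\<lambda>s g. h (s + 1) 0 + ((g + 1) * h s g + (s - g) * h s (g + 1)))"
  unfolding state_sum_def sum_placements_Suc
proof (intro sum.cong refl arg_cong2[where f = "(+)"])
  fix R assume R: "R \<in> placements n"
  show "h (card (empty_columns (Suc n) R)) (card (late_columns (Suc n) R)) =
    h (card (empty_columns n R) + 1) 0"
    using Suc_notin_empty_columns[OF R]
    by (simp add: empty_columns_Suc[OF R] late_columns_Suc[OF R] finite_empty_columns)
qed (rule sum_insert_rook)

lemma state_sum_cong:
  assumes "\<And>s g. g \<le> s \<Longrightarrow> h s g = h' s g"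
  shows "state_sum n h = state_sum n h'"
  unfolding state_sum_def
  by (intro sum.cong refl assms card_mono finite_empty_columns late_columns_subset)

lemma state_sum_add: "state_sum n (\<lambda>s g. h s g + h' s g) = state_sum n h + state_sum n h'"
  by (simp add: state_sum_def sum.distrib)

lemma state_sum_mult: "state_sum n (\<lambda>s g. c * h s g) = c * state_sum n h"
  by (simp add: state_sum_def sum_distrib_left)

definition num_placements :: "nat \<Rightarrow> nat \<Rightarrow> nat" where
  "num_placements n k = state_sum n (\<lambda>s g. of_bool (s = k))"

definition num_state :: "nat \<Rightarrow> nat \<Rightarrow> nat \<Rightarrow> nat" where
  "num_state n k m = state_sum n (\<lambda>s g. of_bool (s = k \<and> g = m))"

text \<open>With \<open>g\<close> forgotten, the \<open>s + 1\<close> ways of placing a rook all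
  keep \<open>s\<close>. This is the recurrence of the Stirling numbers of the second kind S(n+1,
  k+1).\<close>

lemma num_placements_Suc:
  "num_placements (Suc n) k =
    (k + 1) * num_placements n k + (if k = 0 then 0 else num_placements n (k - 1))"
proof -
  have "num_placements (Suc n) k =
    state_sum n (\<lambda>s g. (k + 1) * of_bool (s = k) + of_bool (k \<noteq> 0) * of_bool (s = k - 1))"
    \<comment> \<open>The restriction to \<open>g \<le> s\<close> matters here: the truncated
      difference satisfies \<open>(g + 1) + (s - g) = s + 1\<close> only then.\<close>
    unfolding num_placements_def state_sum_Suc by (rule state_sum_cong) auto
  then show ?thesis
    unfolding state_sum_add state_sum_mult num_placements_def by simp
qed

text \<open>Without late columns, only a rook in the new column preserves the state; an empty last
  row leads here from every \<open>g\<close>, hence the count of all placements.\<close>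

lemma num_state_Suc_0:
  "num_state (Suc n) k 0 =
    num_state n k 0 + (if k = 0 then 0 else num_placements n (k - 1))"
proof -
  have "num_state (Suc n) k 0 =
    state_sum n (\<lambda>s g. of_bool (s = k \<and> g = 0) + of_bool (k \<noteq> 0) * of_bool (s = k - 1))"
    unfolding num_state_def state_sum_Suc by (rule state_sum_cong) auto
  then show ?thesis
    unfolding state_sum_add state_sum_mult num_state_def num_placements_def by simp
qed

lemma num_state_Suc_Suc:
  "num_state (Suc n) k (Suc m) = (m + 2) * num_state n k (Suc m) + (k - m) * num_state n k m"
proof -
  have "num_state (Suc n) k (Suc m) =
    state_sum n (\<lambda>s g. (m + 2) * of_bool (s = k \<and> g = Suc m) + (k - m) * of_bool (s = k \<and> g = m))"
    unfolding num_state_def state_sum_Suc by (rule state_sum_cong) auto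
  then show ?thesis
    unfolding state_sum_add state_sum_mult num_state_def .
qed

lemma num_state_eq_card:
  "num_state n k m =
    card {R \<in> placements n. card (empty_columns n R) = k \<and> card (late_columns n R) = m}"
  unfolding num_state_def state_sum_def
  by (simp add: of_bool_def sum.If_cases finite_placements Int_def)

text \<open>Having \<open>n - k\<close> rooks means having \<open>k\<close> empty columns, and
  maximality means that all of them are late. For \<open>n < k\<close> both sides vanish, since a
  board of size \<open>n\<close> cannot have \<open>k\<close> empty columns.\<close>

lemma maximal_count_eq_num_state: "maximal_count n k = num_state n k k"
proof (cases "n < k")
  case True
  then have "{R \<in> placements n. card (empty_columns n R) = k \<and> card (late_columns n R) = k} = {}"
    using card_empty_columns[of _ n] by fastforce
  then have "num_state n k k = 0"
    by (simp only: num_state_eq_card card.empty)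
  with True show ?thesis by (simp add: maximal_count_def)
next
  case False
  have "maximal_rook_placement (triangular_board n) R \<and> card R = n - k \<longleftrightarrow>
    R \<in> placements n \<and> card (empty_columns n R) = k \<and> card (late_columns n R) = k" for R
  proof (cases "R \<in> placements n")
    case True
    have "card R = n - k \<longleftrightarrow> card (empty_columns n R) = k"
      using False card_empty_columns[OF True] by linarith
    then show ?thesis
      using maximal_iff_card_late_columns[OF True] True by auto
  qed (simp add: maximal_rook_placement_def placements_def)
  then show ?thesis
    using False by (simp add: maximal_count_def num_maximal_def num_state_eq_card)
qed

section \<open>Generating functions and their closed forms\<close>

lemma fps_linear_recurrence:
  fixes a b :: "nat \<Rightarrow> nat"
  assumes "\<And>n. a (Suc n) = c * a n + b n"
  shows "Abs_fps (\<lambda>n. of_nat (a n)) * (1 - of_nat c * fps_X) =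
    of_nat (a 0) + fps_X * (Abs_fps (\<lambda>n. of_nat (b n)) :: 'a::comm_ring_1 fps)"
  (is "?A * _ = _")
proof (rule fps_ext)
  fix n
  have *: "?A * (1 - of_nat c * fps_X) = ?A - of_nat c * (fps_X * ?A)"
    by (simp only: right_diff_distrib mult_1_left mult_1_right mult_ac)
  show "fps_nth (?A * (1 - of_nat c * fps_X)) n =
    fps_nth (of_nat (a 0) + fps_X * Abs_fps (\<lambda>n. of_nat (b n))) n"
    unfolding * by (cases n) (simp_all add: assms)
qed

definition placements_fps :: "nat \<Rightarrow> rat fps" where
  "placements_fps k = Abs_fps (\<lambda>n. of_nat (num_placements n k))"

definition state_fps :: "nat \<Rightarrow> nat \<Rightarrow> rat fps" where
  "state_fps k m = Abs_fps (\<lambda>n. of_nat (num_state n k m))"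

text \<open>The board of size 0 has only the state \<open>(0, 0)\<close>, so the initial value
  contributes the 1 for \<open>k = 0\<close> and nothing otherwise.\<close>

lemma placements_fps_rec:
  "placements_fps k * (1 - of_nat (k + 1) * fps_X) =
    (if k = 0 then 1 else fps_X * placements_fps (k - 1))"
proof -
  have "placements_fps k * (1 - of_nat (k + 1) * fps_X) = of_nat (num_placements 0 k) +
    fps_X * Abs_fps (\<lambda>n. of_nat (if k = 0 then 0 else num_placements n (k - 1)))"
    unfolding placements_fps_def by (intro fps_linear_recurrence num_placements_Suc)
  then show ?thesis
    by (auto simp: num_placements_def state_sum_0 placements_fps_def fps_zero_def[symmetric])
qed

lemma state_fps_rec_0:
  "state_fps k 0 * (1 - fps_X) = (if k = 0 then 1 else fps_X * placements_fps (k - 1))"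
proof -
  have "state_fps k 0 * (1 - of_nat 1 * fps_X) = of_nat (num_state 0 k 0) +
    fps_X * Abs_fps (\<lambda>n. of_nat (if k = 0 then 0 else num_placements n (k - 1)))"
    unfolding state_fps_def by (intro fps_linear_recurrence) (simp add: num_state_Suc_0)
  then show ?thesis
    by (auto simp: num_state_def state_sum_0 placements_fps_def fps_zero_def[symmetric])
qed

lemma state_fps_rec_Suc:
  "state_fps k (Suc m) * (1 - of_nat (m + 2) * fps_X) = of_nat (k - m) * fps_X * state_fps k m"
proof -
  have "state_fps k (Suc m) * (1 - of_nat (m + 2) * fps_X) = of_nat (num_state 0 k (Suc m)) +
    fps_X * Abs_fps (\<lambda>n. of_nat ((k - m) * num_state n k m))"
    unfolding state_fps_def by (intro fps_linear_recurrence num_state_Suc_Suc)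
  moreover have "Abs_fps (\<lambda>n. of_nat ((k - m) * num_state n k m)) = of_nat (k - m) * state_fps k m"
    unfolding fps_of_nat[symmetric] by (rule fps_ext) (simp add: state_fps_def)
  ultimately show ?thesis
    by (simp add: num_state_def state_sum_0 algebra_simps)
qed

lemma placements_fps_closed_form:
  "placements_fps k * (\<Prod>i = 1..k + 1. 1 - of_nat i * fps_X) = fps_X ^ k"
proof (induction k)
  case 0
  show ?case using placements_fps_rec[of 0] by simp
next
  case (Suc k)
  have "placements_fps (Suc k) * (\<Prod>i = 1..Suc k + 1. 1 - of_nat i * fps_X) =
    placements_fps (Suc k) * (1 - of_nat (Suc k + 1) * fps_X) *
      (\<Prod>i = 1..k + 1. 1 - of_nat i * fps_X)"
    by (simp add: prod.nat_ivl_Suc' mult_ac del: of_nat_Suc)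
  also have "\<dots> = fps_X * (placements_fps k * (\<Prod>i = 1..k + 1. 1 - of_nat i * fps_X))"
    unfolding placements_fps_rec by (simp add: mult_ac)
  finally show ?case
    unfolding Suc.IH by simp
qed

text \<open>The product comes from all placements with \<open>k - 1\<close> empty columns, which
  feed the state \<open>(k, 0)\<close>; the separate factor \<open>1 - fps_X\<close> comes from
  remaining in that state.\<close>

lemma state_fps_closed_form_0:
  "state_fps k 0 * (1 - fps_X) * (\<Prod>i = 1..k. 1 - of_nat i * fps_X) = fps_X ^ k"
proof (cases k)
  case (Suc k')
  then show ?thesis
    using placements_fps_closed_form[of k'] unfolding state_fps_rec_0 by (simp add: mult.assoc)
qed (simp add: state_fps_rec_0)

text \<open>Passing from \<open>m\<close> to \<open>m + 1\<close> contributes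
  \<open>(k - m) * fps_X\<close> and the new denominator factor \<open>1 - (m + 2) * fps_X\<close>.
  The accumulated weights are k!/(k-m)!; putting \<open>fact (k - m)\<close> on the left avoids the
  quotient.\<close>

lemma state_fps_closed_form:
  assumes "m \<le> k"
  shows "fact (k - m) * state_fps k m *
      ((\<Prod>i = 1..k. 1 - of_nat i * fps_X) * (\<Prod>i = 1..m + 1. 1 - of_nat i * fps_X)) =
    fact k * fps_X ^ (k + m)"
  using assms
proof (induction m)
  case 0
  show ?case using state_fps_closed_form_0[of k] by (simp add: mult_ac)
next
  case (Suc m)
  let ?P = "\<lambda>k. \<Prod>i = 1..k. 1 - of_nat i * fps_X :: rat fps"
  have "fact (k - Suc m) * state_fps k (Suc m) * (?P k * ?P (Suc m + 1)) =
    fact (k - Suc m) * (state_fps k (Suc m) * (1 - of_nat (m + 2) * fps_X)) * (?P k * ?P (m + 1))"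
    by (simp add: prod.nat_ivl_Suc' mult_ac del: of_nat_Suc)
  also have "\<dots> = (of_nat (k - m) * fact (k - Suc m)) * state_fps k m * (?P k * ?P (m + 1)) * fps_X"
    unfolding state_fps_rec_Suc by (simp add: mult_ac)
  also have "of_nat (k - m) * fact (k - Suc m) = (fact (k - m) :: rat fps)"
    using Suc.prems by (simp add: fact_reduce[of "k - m"])
  also have "fact (k - m) * state_fps k m * (?P k * ?P (m + 1)) = fact k * fps_X ^ (k + m)"
    using Suc by simp
  finally show ?case by (simp add: mult_ac)
qed

theorem corollary4p7:
  fixes k :: nat
  shows "Abs_fps (\<lambda>n. of_nat (maximal_count n k)) =
    (fact k * fps_X ^ (2 * k) /
      ((\<Prod>i = 1..k. 1 - of_nat i * fps_X) ^ 2 * (1 - of_nat (k + 1) * fps_X)) :: rat fps)"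
proof -
  let ?P = "\<Prod>i = 1..k. 1 - of_nat i * fps_X :: rat fps"
  let ?Q = "?P ^ 2 * (1 - of_nat (k + 1) * fps_X)"
  \<comment> \<open>At \<open>m = k\<close> the left factorial is 1, and the product up to
    \<open>k + 1\<close> splits into a second copy of \<open>?P\<close> and the last factor.\<close>
  have "state_fps k k * ?Q = fact k * fps_X ^ (2 * k)"
    using state_fps_closed_form[of k k]
    by (simp add: prod.nat_ivl_Suc' power2_eq_square mult_2 mult_ac del: of_nat_Suc)
  \<comment> \<open>Each factor has constant coefficient 1, so the denominator is nonzero and can be
    cancelled.\<close>
  moreover have "1 - of_nat i * fps_X \<noteq> (0 :: rat fps)" for i
  proof
    assume "1 - of_nat i * fps_X = (0 :: rat fps)"
    then have "fps_nth (1 - of_nat i * fps_X) 0 = (0 :: rat)" by simp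
    then show False by simp
  qed
  then have "?Q \<noteq> 0" by (simp del: of_nat_Suc of_nat_add)
  ultimately have "state_fps k k = fact k * fps_X ^ (2 * k) / ?Q"
    by (metis nonzero_mult_div_cancel_right)
  then show ?thesis
    by (simp add: state_fps_def maximal_count_eq_num_state)
qed

end
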